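(* Let $M,K$ be positive integers and $\rho>0$ be given, and consider the energy efficiency (EE) optimization problem described in the context with these values of $M,K,\rho$ fixed. If the problem is feasible, then the EE metric $\widetilde{\mathrm{EE}}(\rho,\lambda,M,K)$ is monotonically increasing in $\lambda\in(0,\lambda_{\max}]$, and thus it is maximized over $0<\lambda\le\lambda_{\max}$ at $\lambda^*=\lambda_{\max}$.
   Context: Fixed parameters: $\alpha>2$, $\omega>0$, $\sigma^2>0$, $0\le\epsilon<1$, $\eta\in(0,1]$, positive constants $\mathcal{A},\mathcal{C}_0,\mathcal{C}_1,\mathcal{D}_0,\mathcal{D}_1$, a maximal access point density $\lambda_{\max}\in(0,\infty)$, and a target spectral efficiency $\gamma$ with $0\le\gamma<-2\log_2(\epsilon)$ (upper bound $+\infty$ if $\epsilon=0$). Spectral efficiency bound: $$\widetilde{\mathrm{SE}}=\log_2\left(1+\frac{(1-\epsilon^2)(M-K)}{\frac{2K}{\alpha-2}+\epsilon^2(M-K)+\frac{\Gamma(\alpha/2+1)}{(\pi\lambda)^{\alpha/2}}\frac{\omega\sigma^2}{\rho}}\right).$$ EE metric: $$\widetilde{\mathrm{EE}}(\rho,\lambda,M,K)=\frac{\lambda K\,\widetilde{\mathrm{SE}}}{\lambda\left(\frac{K\rho}{\eta}+\mathcal{C}_0+\mathcal{C}_1K+\mathcal{D}_0M+\mathcal{D}_1MK+\mathcal{A}K\,\widetilde{\mathrm{SE}}\right)}.$$ EE optimization problem: maximize $\widetilde{\mathrm{EE}}(\rho,\lambda,M,K)$ over $\rho$, $\lambda$ with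 $\lambda\le\lambda_{\max}$, and positive integers $M,K$, subject to $\widetilde{\mathrm{SE}}=\gamma$ and $M\ge K+1$. For fixed $(M,K,\rho)$ it is feasible if $M\ge K+1$ and $\widetilde{\mathrm{SE}}=\gamma$ for some admissible $\lambda$. *)

theory Defs
  imports "HOL-Analysis.Analysis"
begin

text \<open>
  The access point density is called \<open>d\<close>, since the usual letter is the binder symbol;
  \<open>d_max\<close> is its maximal value. The number of antennas \<open>M\<close> and of users \<open>K\<close> are natural
  numbers; they are cast to reals before being subtracted, so \<open>real M - real K\<close> does not truncate.
\<close>

definition SE_bound ::
  "real \<Rightarrow> real \<Rightarrow> real \<Rightarrow> real \<Rightarrow> real \<Rightarrow> real \<Rightarrow> nat \<Rightarrow> nat \<Rightarrow> real" where
  "SE_bound \<alpha> \<omega> \<sigma> \<epsilon> \<rho> d M K =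
     log 2 (1 + (1 - \<epsilon>\<^sup>2) * (real M - real K) /
       (2 * real K / (\<alpha> - 2) + \<epsilon>\<^sup>2 * (real M - real K)
         + Gamma (\<alpha> / 2 + 1) / (pi * d) powr (\<alpha> / 2) * (\<omega> * \<sigma>\<^sup>2 / \<rho>)))"

definition EE_metric ::
  "real \<Rightarrow> real \<Rightarrow> real \<Rightarrow> real \<Rightarrow> real \<Rightarrow> real \<Rightarrow> real \<Rightarrow> real \<Rightarrow> real \<Rightarrow> real \<Rightarrow>
   real \<Rightarrow> real \<Rightarrow> nat \<Rightarrow> nat \<Rightarrow> real" where
  "EE_metric \<alpha> \<omega> \<sigma> \<epsilon> \<eta> A C\<^sub>0 C\<^sub>1 D\<^sub>0 D\<^sub>1 \<rho> d M K =
     d * real K * SE_bound \<alpha> \<omega> \<sigma> \<epsilon> \<rho> d M K /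
     (d * (real K * \<rho> / \<eta> + C\<^sub>0 + C\<^sub>1 * real K + D\<^sub>0 * real M + D\<^sub>1 * real M * real K
           + A * real K * SE_bound \<alpha> \<omega> \<sigma> \<epsilon> \<rho> d M K))"

definition EE_constraints ::
  "real \<Rightarrow> real \<Rightarrow> real \<Rightarrow> real \<Rightarrow> real \<Rightarrow> real \<Rightarrow> real \<Rightarrow> real \<Rightarrow> nat \<Rightarrow> nat \<Rightarrow> bool" where
  "EE_constraints \<alpha> \<omega> \<sigma> \<epsilon> d_max \<gamma> \<rho> d M K \<longleftrightarrow>
     0 < \<rho> \<and> 0 < d \<and> d \<le> d_max \<and> 1 \<le> M \<and> 1 \<le> K \<and>
     SE_bound \<alpha> \<omega> \<sigma> \<epsilon> \<rho> d M K = \<gamma> \<and> M \<ge> K + 1"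

text \<open>Feasibility of the problem when only the density is left to be chosen.\<close>

definition EE_feasible ::
  "real \<Rightarrow> real \<Rightarrow> real \<Rightarrow> real \<Rightarrow> real \<Rightarrow> real \<Rightarrow> real \<Rightarrow> nat \<Rightarrow> nat \<Rightarrow> bool" where
  "EE_feasible \<alpha> \<omega> \<sigma> \<epsilon> d_max \<gamma> \<rho> M K \<longleftrightarrow>
     (\<exists>d. EE_constraints \<alpha> \<omega> \<sigma> \<epsilon> d_max \<gamma> \<rho> d M K)"

end

theory Submission
  imports Defs
begin

text \<open>
  After cancelling the density, the metric is \<open>K S / (B + A K S)\<close> with \<open>S\<close> the spectral
  efficiency bound and \<open>B > 0\<close> independent of the density, so it increases with \<open>S\<close>; and \<open>S\<close>
  increases with the density because the noise term decreases. Feasibility gives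
  \<open>M > K\<close>, which makes the signal term positive.
\<close>

text \<open>Cross-multiplying by the positive denominators puts the same product of
  \<open>a\<close>, \<open>k\<close>, \<open>k\<close>, \<open>s\<close>, \<open>t\<close> on both
  sides; what is left is \<open>k * s * b < k * t * b\<close>.\<close>

lemma saturating_strict_mono:
  fixes a b k s t :: real
  assumes "0 < b" "0 < a" "0 < k" "0 \<le> s" "s < t"
  shows "k * s / (b + a * k * s) < k * t / (b + a * k * t)"
proof -
  have pos: "0 < b + a * k * s" "0 < b + a * k * t"
    using assms by (auto intro!: add_pos_nonneg)
  have "k * s * b < k * t * b"
    using assms by simp
  then have "k * s * (b + a * k * t) < k * t * (b + a * k * s)"
    by (simp add: algebra_simps)
  with pos show ?thesis
    by (simp only: pos_divide_less_eq pos_less_divide_eq times_divide_eq_left)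
qed

text \<open>Supplies the sign condition on \<open>s\<close> in
  \<open>saturating_strict_mono\<close>. The fraction inside the logarithm is positive, its
  denominator thanks to the interference term \<open>2 * real K / (\<alpha> - 2)\<close>.\<close>

lemma SE_bound_pos:
  assumes "\<alpha> > 2" "\<omega> > 0" "\<rho> > 0" "\<bar>\<epsilon>\<bar> < 1" "K < M" "0 < K" "0 < d"
  shows "0 < SE_bound \<alpha> \<omega> \<sigma> \<epsilon> \<rho> d M K"
proof -
  have "\<epsilon>\<^sup>2 < 1"
    using assms(4) by (simp add: abs_square_less_1)
  moreover have "Gamma (\<alpha> / 2 + 1) > 0"
    using assms(1) by (intro Gamma_real_pos) simp
  moreover from this have "0 < 2 * real K / (\<alpha> - 2) + \<epsilon>\<^sup>2 * (real M - real K)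
      + Gamma (\<alpha> / 2 + 1) / (pi * d) powr (\<alpha> / 2) * (\<omega> * \<sigma>\<^sup>2 / \<rho>)"
    using assms by (intro add_pos_nonneg) auto
  ultimately show ?thesis
    using assms(5) by (simp add: SE_bound_def add_pos_pos)
qed

lemma SE_bound_strict_mono:
  assumes "\<alpha> > 2" "\<omega> > 0" "\<sigma> \<noteq> 0" "\<rho> > 0" "\<bar>\<epsilon>\<bar> < 1" "K < M" "0 < K" "0 < x" "x < y"
  shows "SE_bound \<alpha> \<omega> \<sigma> \<epsilon> \<rho> x M K < SE_bound \<alpha> \<omega> \<sigma> \<epsilon> \<rho> y M K"
proof -
  \<comment> \<open>The logarithm is taken of \<open>1 + n / (c + g d)\<close>, where only the noise
    term \<open>g\<close> depends on the density, as a negative power of it.\<close>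
  define n where "n = (1 - \<epsilon>\<^sup>2) * (real M - real K)"
  define c where "c = 2 * real K / (\<alpha> - 2) + \<epsilon>\<^sup>2 * (real M - real K)"
  define g where "g d = Gamma (\<alpha> / 2 + 1) / (pi * d) powr (\<alpha> / 2) * (\<omega> * \<sigma>\<^sup>2 / \<rho>)" for d
  have "\<epsilon>\<^sup>2 < 1"
    using assms(5) by (simp add: abs_square_less_1)
  then have n: "n > 0"
    using assms(6) by (simp add: n_def)
  have c: "c > 0"
    unfolding c_def using assms by (intro add_pos_nonneg) auto
  have Gam: "Gamma (\<alpha> / 2 + 1) > 0"
    using assms(1) by (intro Gamma_real_pos) simp
  have gy: "g y > 0"
    unfolding g_def using Gam assms by (intro mult_pos_pos divide_pos_pos) auto
  have powr: "(pi * x) powr (\<alpha> / 2) < (pi * y) powr (\<alpha> / 2)"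
    using assms by (intro powr_less_mono2) auto
  have "g y < g x"
    unfolding g_def
  proof (rule mult_strict_right_mono)
    show "Gamma (\<alpha> / 2 + 1) / (pi * y) powr (\<alpha> / 2) < Gamma (\<alpha> / 2 + 1) / (pi * x) powr (\<alpha> / 2)"
      using powr Gam assms by (intro divide_strict_left_mono) auto
    show "0 < \<omega> * \<sigma>\<^sup>2 / \<rho>"
      using assms by simp
  qed
  then have "n / (c + g x) < n / (c + g y)"
    using n c gy by (intro divide_strict_left_mono) auto
  \<comment> \<open>Both arguments of the logarithm thus exceed 1 and lie where \<open>log 2\<close>
    is strictly increasing.\<close>
  moreover have "0 < n / (c + g x)"
    using n c gy \<open>g y < g x\<close> by simp
  ultimately have "log 2 (1 + n / (c + g x)) < log 2 (1 + n / (c + g y))"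
    by simp
  then show ?thesis
    by (simp add: SE_bound_def n_def c_def g_def)
qed

theorem theorem1:
  fixes \<alpha> \<omega> \<sigma> \<epsilon> \<eta> A C\<^sub>0 C\<^sub>1 D\<^sub>0 D\<^sub>1 d_max \<gamma> \<rho> :: real
    and M K :: nat
  assumes "\<alpha> > 2" and "\<omega> > 0" and "\<sigma>\<^sup>2 > 0"
    and "0 \<le> \<epsilon>" and "\<epsilon> < 1"
    and "0 < \<eta>" and "\<eta> \<le> 1"
    and "A > 0" and "C\<^sub>0 > 0" and "C\<^sub>1 > 0" and "D\<^sub>0 > 0" and "D\<^sub>1 > 0"
    and "d_max > 0"
    and "0 \<le> \<gamma>" and "\<epsilon> > 0 \<longrightarrow> \<gamma> < - 2 * log 2 \<epsilon>"
    and "M > 0" and "K > 0" and "\<rho> > 0"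
    and "EE_feasible \<alpha> \<omega> \<sigma> \<epsilon> d_max \<gamma> \<rho> M K"
  shows "strict_mono_on {0<..d_max} (\<lambda>d. EE_metric \<alpha> \<omega> \<sigma> \<epsilon> \<eta> A C\<^sub>0 C\<^sub>1 D\<^sub>0 D\<^sub>1 \<rho> d M K) \<and>
    is_arg_max (\<lambda>d. EE_metric \<alpha> \<omega> \<sigma> \<epsilon> \<eta> A C\<^sub>0 C\<^sub>1 D\<^sub>0 D\<^sub>1 \<rho> d M K) (\<lambda>d. 0 < d \<and> d \<le> d_max) d_max"
proof
  let ?S = "\<lambda>d. SE_bound \<alpha> \<omega> \<sigma> \<epsilon> \<rho> d M K"
  let ?E = "\<lambda>d. EE_metric \<alpha> \<omega> \<sigma> \<epsilon> \<eta> A C\<^sub>0 C\<^sub>1 D\<^sub>0 D\<^sub>1 \<rho> d M K"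
  let ?B = "real K * \<rho> / \<eta> + C\<^sub>0 + C\<^sub>1 * real K + D\<^sub>0 * real M + D\<^sub>1 * real M * real K"
  \<comment> \<open>This constraint does not involve the density, so it passes from the feasible
    density to the whole interval.\<close>
  have KM: "K < M"
    using assms(19) by (auto simp: EE_feasible_def EE_constraints_def)
  have B: "?B > 0"
    using assms by (intro add_pos_pos mult_pos_pos divide_pos_pos) auto
  show mono: "strict_mono_on {0<..d_max} ?E"
  proof (rule strict_mono_onI)
    fix x y assume xy: "x \<in> {0<..d_max}" "y \<in> {0<..d_max}" "x < y"
    \<comment> \<open>Cancelling \<open>d\<close> requires \<open>d \<noteq> 0\<close>, hence the
      condition; reassociating first exposes \<open>d\<close> as the leading factor of the
      numerator.\<close>
    have E: "?E d = real K * ?S d / (?B + A * real K * ?S d)" if "0 < d" for d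
      unfolding EE_metric_def using that by (simp only: mult.assoc mult_divide_mult_cancel_left)
    have Sx: "0 < ?S x"
      using assms KM xy by (intro SE_bound_pos) auto
    have Sxy: "?S x < ?S y"
      using assms KM xy by (intro SE_bound_strict_mono) auto
    have "real K * ?S x / (?B + A * real K * ?S x) < real K * ?S y / (?B + A * real K * ?S y)"
      using saturating_strict_mono[OF B _ _ less_imp_le[OF Sx] Sxy] assms(8,17) by simp
    then show "?E x < ?E y"
      using xy by (simp only: E greaterThanAtMost_iff)
  qed
  show "is_arg_max ?E (\<lambda>d. 0 < d \<and> d \<le> d_max) d_max"
    unfolding is_arg_max_def
  proof (intro conjI notI)
    assume "\<exists>d. (0 < d \<and> d \<le> d_max) \<and> ?E d_max < ?E d"
    then obtain d where d: "0 < d" "d \<le> d_max" "?E d_max < ?E d"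
      by blast
    then have "?E d \<le> ?E d_max"
      \<comment> \<open>Strict monotonicity compares distinct points only, so the endpoint is a
        separate, trivial case.\<close>
      using strict_mono_onD[OF mono, of d d_max] by (cases "d = d_max") auto
    with d show False
      by simp
  qed (use assms in auto)
qed

end
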